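(* For any $0<p<1$ there is a constant $c_p>0$ such that for any two sets of $n$ points $X=\{x_1,\dots,x_n\}$ and $Y=\{y_1,\dots,y_n\}$ in any metric space with metric $d$, the greedy matching produces a matching satisfying, with respect to the cost function $c(x,y)=d(x,y)^p$, $$\mathrm{Greedy}_p(X,Y)\;\le\; c_p\cdot W_1(X,Y)^p\cdot\begin{cases} n^{1-p} & \text{if } 0<p<\tfrac12,\\ \sqrt{n}\cdot\log n & \text{if } p=\tfrac12,\\ n^{p} & \text{if } \tfrac12<p<1.\end{cases}$$
   Context: Greedy matching: given $X=\{x_1,\dots,x_n\}$, $Y=\{y_1,\dots,y_n\}$ and a cost function $c$, repeat the following until both sets are empty: (1) determine the minimum $m$ of $c(x_i,y_j)$ over all remaining $x_i\in X$ and $y_j\in Y$; (2) find a remaining pair $(x_i,y_j)$ with $c(x_i,y_j)=m$ and set $\pi(i)=j$; (3) remove $x_i$ from $X$ and $y_j$ from $Y$. This yields a permutation $\pi\in S_n$. The cost of the greedy matching $\pi$ is $\mathrm{Greedy}_p(X,Y)=\sum_{i=1}^n d(x_i,y_{\pi(i)})^p$. The Wasserstein distance is (unnormalized) $W_1(X,Y)=\inf_{\sigma\in S_n}\sum_{i=1}^n d(x_i,y_{\sigma(i)})$, where $S_n$ is the set of permutations of $\{1,\dots,n\}$.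
   Formalization: For p = 1/2 the bound is stated for n ≥ 2, since for n = 1 its right side is 0 and it fails for two distinct points; c_p is chosen for metric spaces inside one fixed carrier type, and the natural numbers as carrier give the uniform constant, as only finitely many points matter. *)

theory Defs
  imports "HOL-Analysis.Abstract_Metric_Spaces" "HOL-Combinatorics.Permutations"
begin

(* A state consists of the indices of the remaining points of X, the indices of the
   remaining points of Y, and the assignment made so far. The relation is
   nondeterministic: any minimizing pair may be chosen. *)
inductive greedy_step ::
  "('a \<Rightarrow> 'b \<Rightarrow> real) \<Rightarrow> (nat \<Rightarrow> 'a) \<Rightarrow> (nat \<Rightarrow> 'b) \<Rightarrow>
   nat set \<times> nat set \<times> (nat \<Rightarrow> nat) \<Rightarrow> nat set \<times> nat set \<times> (nat \<Rightarrow> nat) \<Rightarrow> bool"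
  for c x y where
  "\<lbrakk>i \<in> I; j \<in> J; c (x i) (y j) = Min {c (x i') (y j') | i' j'. i' \<in> I \<and> j' \<in> J}\<rbrakk>
   \<Longrightarrow> greedy_step c x y (I, J, \<pi>) (I - {i}, J - {j}, \<pi>(i := j))"

(* Starting from the identity only fixes the values outside {1..n}: every index in {1..n}
   is assigned exactly once during a complete run. *)
definition greedy_matching ::
  "('a \<Rightarrow> 'b \<Rightarrow> real) \<Rightarrow> nat \<Rightarrow> (nat \<Rightarrow> 'a) \<Rightarrow> (nat \<Rightarrow> 'b) \<Rightarrow> (nat \<Rightarrow> nat) \<Rightarrow> bool" where
  "greedy_matching c n x y \<pi> \<longleftrightarrow>
     (greedy_step c x y)\<^sup>*\<^sup>* ({1..n}, {1..n}, id) ({}, {}, \<pi>)"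

definition matching_cost ::
  "('a \<Rightarrow> 'b \<Rightarrow> real) \<Rightarrow> nat \<Rightarrow> (nat \<Rightarrow> 'a) \<Rightarrow> (nat \<Rightarrow> 'b) \<Rightarrow> (nat \<Rightarrow> nat) \<Rightarrow> real" where
  "matching_cost c n x y \<sigma> = (\<Sum>i = 1..n. c (x i) (y (\<sigma> i)))"

(* Unnormalized: there is no factor 1/n. *)
definition wasserstein1 ::
  "('a \<Rightarrow> 'a \<Rightarrow> real) \<Rightarrow> nat \<Rightarrow> (nat \<Rightarrow> 'a) \<Rightarrow> (nat \<Rightarrow> 'a) \<Rightarrow> real" where
  "wasserstein1 d n x y = (INF \<sigma> \<in> {\<sigma>. \<sigma> permutes {1..n}}. matching_cost d n x y \<sigma>)"

lemma greedy_matching_permutes: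
  assumes "greedy_matching c n x y \<pi>"
  shows "\<pi> permutes {1..n}"
proof -
  define P where "P = (\<lambda>(I, J, \<rho>). I \<subseteq> {1..n} \<and> J \<subseteq> {1..n} \<and>
      bij_betw \<rho> ({1..n} - I) ({1..n} - J) \<and> (\<forall>k. k \<notin> {1..n} \<longrightarrow> \<rho> k = k))"
  have step: "P t" if "greedy_step c x y s t" "P s" for s t
    using that
  proof cases
    case (1 i I j J \<rho>)
    have sub: "I \<subseteq> {1..n}" "J \<subseteq> {1..n}" and bij: "bij_betw \<rho> ({1..n} - I) ({1..n} - J)"
      and out: "\<forall>k. k \<notin> {1..n} \<longrightarrow> \<rho> k = k"
      using \<open>P s\<close> 1 by (auto simp: P_def)
    have "bij_betw (\<rho>(i := j)) ({1..n} - I) ({1..n} - J)"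
      using bij 1 by (subst bij_betw_cong[where g = \<rho>]) auto
    then have "bij_betw (\<rho>(i := j)) (({1..n} - I) \<union> {i}) (({1..n} - J) \<union> {j})"
      by (rule bij_betw_combine) (use 1 in auto)
    moreover have "({1..n} - I) \<union> {i} = {1..n} - (I - {i})" "({1..n} - J) \<union> {j} = {1..n} - (J - {j})"
      using 1 sub by auto
    ultimately show ?thesis
      using 1 sub out by (auto simp: P_def)
  qed
  have "P t" if "(greedy_step c x y)\<^sup>*\<^sup>* s t" "P s" for s t
    using that by (induction rule: rtranclp_induct) (auto intro: step)
  moreover have "P ({1..n}, {1..n}, id)"
    by (simp add: P_def)
  ultimately have "P ({}, {}, \<pi>)"
    using assms unfolding greedy_matching_def by blast
  then show ?thesis
    by (auto simp: P_def intro: bij_imp_permutes)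
qed

lemma greedy_matching_exists: "\<exists>\<pi>. greedy_matching c n x y \<pi>"
proof -
  have "\<exists>\<pi>. (greedy_step c x y)\<^sup>*\<^sup>* (I, J, \<rho>) ({}, {}, \<pi>)"
    if "finite I" "finite J" "card I = m" "card J = m" for I J \<rho> m
    using that
  proof (induction m arbitrary: I J \<rho>)
    case 0
    then show ?case by auto
  next
    case (Suc m)
    let ?C = "{c (x i') (y j') | i' j'. i' \<in> I \<and> j' \<in> J}"
    have "finite ?C"
      using Suc.prems by (auto intro: finite_image_set2)
    moreover obtain a b where "a \<in> I" "b \<in> J"
      using Suc.prems by (metis card.empty ex_in_conv nat.distinct(1))
    then have "?C \<noteq> {}" by auto
    ultimately have "Min ?C \<in> ?C" by (rule Min_in)
    then obtain i j where ij: "i \<in> I" "j \<in> J" "c (x i) (y j) = Min ?C" by auto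
    then have "greedy_step c x y (I, J, \<rho>) (I - {i}, J - {j}, \<rho>(i := j))"
      by (rule greedy_step.intros)
    moreover have "\<exists>\<pi>. (greedy_step c x y)\<^sup>*\<^sup>* (I - {i}, J - {j}, \<rho>(i := j)) ({}, {}, \<pi>)"
      by (rule Suc.IH) (use Suc.prems ij in auto)
    ultimately show ?case
      by (meson converse_rtranclp_into_rtranclp)
  qed
  then show ?thesis
    unfolding greedy_matching_def by (metis finite_atLeastAtMost)
qed

end

theory Submission
  imports Defs "HOL-Analysis.Harmonic_Numbers"
begin

text \<open>
  Consider a moment of the run at which \<open>m\<close> pairs remain, and let \<open>w\<close> be the cost \<open>\<Sum> d\<close> (with
  exponent 1) of some matching of the remaining points. As \<open>t \<mapsto> t\<^sup>p\<close> is increasing, the greedy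
  pair also minimizes \<open>d\<close>, so its distance \<open>g\<close> is at most the average \<open>w / m\<close>. Removing this pair
  leaves at most two orphans, the former partners of its two points; matching them with each other costs at
  most \<open>g\<close> more, by the triangle inequality. Hence the \<open>m - 1\<close> remaining pairs have a matching of cost
  at most \<open>w + g \<le> w (m + 1) / m\<close> (\<open>matching_reroute\<close>).

  The factors \<open>(m + 1) / m\<close> telescope. Starting from an optimal matching, of cost \<open>W\<close>, the cost is
  at most \<open>W (n + 1) / (m + 1)\<close> when \<open>m\<close> pairs remain, so the greedy pair chosen then has distance at
  most \<open>W (n + 1) / (m (m + 1)) \<le> 2 W n / m\<^sup>2\<close> (\<open>greedy_run_cost_le\<close>). Summing the \<open>p\<close>-th powers bounds the greedy cost by
  \<open>2\<^sup>p W\<^sup>p n\<^sup>p (\<Sum>m = 1..n. m\<^sup>-\<^sup>2\<^sup>p)\<close>. The three regimes of the theorem are the three growth rates of this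
  last sum: \<open>n\<^sup>1\<^sup>-\<^sup>2\<^sup>p\<close> for \<open>2 p < 1\<close>, \<open>ln n\<close> for \<open>2 p = 1\<close>, and bounded for \<open>2 p > 1\<close>
  (\<open>powr_times_sum_powr_le_greedy_rate\<close>).
\<close>

section \<open>Properties of greedy runs\<close>

lemma greedy_step_cost_minimal:
  assumes "greedy_step c x y (I, J, \<rho>) s" "finite I" "finite J"
  obtains i j where "i \<in> I" "j \<in> J" "s = (I - {i}, J - {j}, \<rho>(i := j))"
    "\<And>i' j'. i' \<in> I \<Longrightarrow> j' \<in> J \<Longrightarrow> c (x i) (y j) \<le> c (x i') (y j')"
  using assms(1)
proof cases
  case (1 i j)
  have "finite {c (x i') (y j') | i' j'. i' \<in> I \<and> j' \<in> J}"
    using assms(2,3) by (auto intro: finite_image_set2)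
  then have "c (x i) (y j) \<le> c (x i') (y j')" if "i' \<in> I" "j' \<in> J" for i' j'
    unfolding 1(4) using that by (intro Min_le) auto
  with 1 that show thesis by blast
qed

lemma greedy_run_assignment_unchanged:
  assumes "(greedy_step c x y)\<^sup>*\<^sup>* (I, J, \<rho>) (I', J', \<pi>)" "k \<notin> I"
  shows "\<pi> k = \<rho> k"
  using assms
proof (induction "(I, J, \<rho>)" arbitrary: I J \<rho> rule: converse_rtranclp_induct)
  case base
  then show ?case by simp
next
  case (step s)
  from step.hyps(1) step.hyps(3) step.prems show ?case
    by cases auto
qed

section \<open>Rerouting a matching\<close>

text \<open>
  Unless \<open>f\<close> already matches \<open>i\<close> with \<open>j\<close>, their partners \<open>f i\<close> and \<open>k\<close>, where \<open>f k = j\<close>, become orphans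
  when \<open>i\<close> and \<open>j\<close> are removed. They are matched with each other; the detour from \<open>x k\<close> through \<open>y j\<close>
  and \<open>x i\<close> to \<open>y (f i)\<close> uses two distances of the old matching and the new distance \<open>d (x i) (y j)\<close>.
\<close>

lemma (in Metric_space) matching_reroute:
  assumes f: "bij_betw f I J" and "finite I" and ij: "i \<in> I" "j \<in> J"
    and M: "x ` I \<subseteq> M" "y ` J \<subseteq> M"
  obtains h where "bij_betw h (I - {i}) (J - {j})"
    "(\<Sum>k\<in>I - {i}. d (x k) (y (h k))) \<le> (\<Sum>k\<in>I. d (x k) (y (f k))) + d (x i) (y j)"
proof -
  obtain k where k: "k \<in> I" "f k = j"
    using f ij by (auto simp: bij_betw_def)
  define h where "h = f \<circ> Transposition.transpose i k"
  have "bij_betw (Transposition.transpose i k) I I"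
    using ij k by simp
  then have "bij_betw h I J"
    unfolding h_def using f by (rule bij_betw_trans)
  moreover have "h i = j"
    by (simp add: h_def k)
  ultimately have bij: "bij_betw h (I - {i}) (J - {j})"
    using ij by (intro bij_betw_DiffI) auto
  show thesis
  proof (cases "k = i")
    case True
    then have "h = f" by (simp add: h_def)
    moreover have "(\<Sum>k\<in>I - {i}. d (x k) (y (f k))) \<le> (\<Sum>k\<in>I. d (x k) (y (f k)))"
      using \<open>finite I\<close> by (intro sum_mono2) auto
    ultimately show thesis
      using bij that[of h] nonneg[of "x i" "y j"] by (simp add: add_increasing2)
  next
    case False
    have split: "(\<Sum>l\<in>I. d (x l) (y (f l))) =
        d (x i) (y (f i)) + (d (x k) (y j) + (\<Sum>l\<in>I - {i} - {k}. d (x l) (y (f l))))"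
      using \<open>finite I\<close> ij k False by (simp add: sum.remove[of I i] sum.remove[of "I - {i}" k])
    have "(\<Sum>l\<in>I - {i}. d (x l) (y (h l))) =
        d (x k) (y (h k)) + (\<Sum>l\<in>I - {i} - {k}. d (x l) (y (h l)))"
      using \<open>finite I\<close> k False by (simp add: sum.remove[of "I - {i}" k])
    also have "(\<Sum>l\<in>I - {i} - {k}. d (x l) (y (h l))) = (\<Sum>l\<in>I - {i} - {k}. d (x l) (y (f l)))"
      by (intro sum.cong) (auto simp: h_def Transposition.transpose_def)
    also have "h k = f i"
      by (simp add: h_def)
    also have "d (x k) (y (f i)) \<le> d (x k) (y j) + (d (x i) (y j) + d (x i) (y (f i)))"
    proof -
      have "f i \<in> J"
        using f ij by (auto simp: bij_betw_def)
      then have "x k \<in> M" "x i \<in> M" "y j \<in> M" "y (f i) \<in> M"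
        using M ij k by auto
      then show ?thesis
        using triangle[of "x k" "y j" "y (f i)"] triangle[of "y j" "x i" "y (f i)"]
          commute[of "y j" "x i"] by linarith
    qed
    finally show thesis
      using split bij that[of h] by linarith
  qed
qed

section \<open>The telescoping bound\<close>

text \<open>
  The \<open>k\<close>-th summand on the right is the bound for the pair chosen when \<open>k\<close> pairs remain. With \<open>w\<close> the
  cost of \<open>f\<close>, the product \<open>w * (m + 1)\<close> does not grow along the run; this is why the induction closes.
\<close>

lemma (in Metric_space) greedy_run_cost_le:
  assumes "0 < p"
    and "(greedy_step (\<lambda>u v. d u v powr p) x y)\<^sup>*\<^sup>* (I, J, \<rho>) ({}, {}, \<pi>)"
    and "finite I" "card I = m" "bij_betw f I J" "x ` I \<subseteq> M" "y ` J \<subseteq> M"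
  shows "(\<Sum>i\<in>I. d (x i) (y (\<pi> i)) powr p)
    \<le> (\<Sum>k=1..m. ((\<Sum>i\<in>I. d (x i) (y (f i))) * (real m + 1) / (real k * (real k + 1))) powr p)"
  using assms(2-)
proof (induction m arbitrary: I J \<rho> f)
  case 0
  then show ?case by simp
next
  case (Suc m)
  note fin = \<open>finite I\<close> and f = \<open>bij_betw f I J\<close>
  let ?w = "\<Sum>i\<in>I. d (x i) (y (f i))"
  have w_nonneg: "0 \<le> ?w"
    by (simp add: sum_nonneg)
  have "finite J"
    using fin f bij_betw_finite by blast
  have "I \<noteq> {}"
    using Suc.prems by auto
  with Suc.prems(1) obtain s where
    s: "greedy_step (\<lambda>u v. d u v powr p) x y (I, J, \<rho>) s"
      "(greedy_step (\<lambda>u v. d u v powr p) x y)\<^sup>*\<^sup>* s ({}, {}, \<pi>)"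
    by (metis converse_rtranclpE prod.inject)
  from greedy_step_cost_minimal[OF s(1) fin \<open>finite J\<close>]
  obtain i j where ij: "i \<in> I" "j \<in> J" and s_eq: "s = (I - {i}, J - {j}, \<rho>(i := j))"
    and min_powr: "\<And>i' j'. i' \<in> I \<Longrightarrow> j' \<in> J \<Longrightarrow> d (x i) (y j) powr p \<le> d (x i') (y j') powr p"
    by blast
  let ?g = "d (x i) (y j)"
  have min: "?g \<le> d (x i') (y j')" if "i' \<in> I" "j' \<in> J" for i' j'
    using min_powr[OF that] powr_less_mono2[OF \<open>0 < p\<close>, of "d (x i') (y j')" ?g]
    by (meson linorder_not_less nonneg)
  have "real (Suc m) * ?g \<le> ?w"
    using sum_bounded_below[of I ?g "\<lambda>i. d (x i) (y (f i))"] min f Suc.prems(3)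
    by (auto simp: bij_betw_def)
  then have g_le: "?g \<le> ?w / real (Suc m)"
    by (simp add: field_simps)
  obtain h where h: "bij_betw h (I - {i}) (J - {j})"
    and h_cost: "(\<Sum>l\<in>I - {i}. d (x l) (y (h l))) \<le> ?w + ?g"
    using matching_reroute[OF f fin ij Suc.prems(5,6)] by blast
  let ?w' = "\<Sum>l\<in>I - {i}. d (x l) (y (h l))"
  have invariant: "?w' * (real m + 1) \<le> ?w * (real (Suc m) + 1)"
  proof -
    have "?w' * (real m + 1) \<le> (?w + ?w / real (Suc m)) * (real m + 1)"
      using h_cost g_le by (intro mult_right_mono) auto
    also have "\<dots> = ?w * (real (Suc m) + 1)"
      by (simp add: field_simps)
    finally show ?thesis .
  qed
  have "(\<Sum>l\<in>I - {i}. d (x l) (y (\<pi> l)) powr p)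
      \<le> (\<Sum>k=1..m. (?w' * (real m + 1) / (real k * (real k + 1))) powr p)"
    using Suc.IH[OF s(2)[unfolded s_eq] _ _ h] Suc.prems ij by auto
  also have "\<dots> \<le> (\<Sum>k=1..m. (?w * (real (Suc m) + 1) / (real k * (real k + 1))) powr p)"
    using invariant \<open>0 < p\<close>
    by (intro sum_mono powr_mono2 divide_right_mono) (auto intro!: divide_nonneg_nonneg mult_nonneg_nonneg sum_nonneg)
  finally have rest: "(\<Sum>l\<in>I - {i}. d (x l) (y (\<pi> l)) powr p) \<le> \<dots>" .
  have "\<pi> i = j"
    using greedy_run_assignment_unchanged[OF s(2)[unfolded s_eq], of i] by simp
  then have "d (x i) (y (\<pi> i)) powr p \<le> (?w / real (Suc m)) powr p"
    using g_le \<open>0 < p\<close> by (simp add: powr_mono2)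
  also have "?w / real (Suc m) = ?w * (real (Suc m) + 1) / (real (Suc m) * (real (Suc m) + 1))"
    by (simp add: divide_simps)
  finally have first: "d (x i) (y (\<pi> i)) powr p \<le>
    (?w * (real (Suc m) + 1) / (real (Suc m) * (real (Suc m) + 1))) powr p" .
  show ?case
    using add_mono[OF first rest]
    by (simp add: sum.remove[OF fin ij(1), where g = "\<lambda>l. d (x l) (y (\<pi> l)) powr p"]
        add.commute)
qed

lemma wasserstein1_attained:
  obtains \<sigma> where "\<sigma> permutes {1..n}" "wasserstein1 d n x y = matching_cost d n x y \<sigma>"
proof -
  let ?S = "{\<sigma>. \<sigma> permutes {1..n}}"
  have "finite ?S" "id \<in> ?S"
    by (simp_all add: finite_permutations permutes_id)
  then have "wasserstein1 d n x y \<in> matching_cost d n x y ` ?S"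
    unfolding wasserstein1_def by (subst cInf_eq_Min) (blast intro!: Min_in)+
  with that show thesis by auto
qed

lemma (in Metric_space) greedy_cost_le_wasserstein1:
  assumes "0 < p" and greedy: "greedy_matching (\<lambda>u v. d u v powr p) n x y \<pi>"
    and M: "\<forall>i\<in>{1..n}. x i \<in> M \<and> y i \<in> M"
  shows "matching_cost (\<lambda>u v. d u v powr p) n x y \<pi>
    \<le> 2 powr p * wasserstein1 d n x y powr p * (real n powr p * (\<Sum>k=1..n. real k powr (- 2 * p)))"
proof -
  obtain \<sigma> where \<sigma>: "\<sigma> permutes {1..n}" and W: "wasserstein1 d n x y = matching_cost d n x y \<sigma>"
    by (rule wasserstein1_attained)
  define w where "w = wasserstein1 d n x y"
  have w_eq: "w = (\<Sum>i=1..n. d (x i) (y (\<sigma> i)))"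
    by (simp add: w_def W matching_cost_def)
  then have "0 \<le> w"
    by (simp add: sum_nonneg)
  have "matching_cost (\<lambda>u v. d u v powr p) n x y \<pi>
      \<le> (\<Sum>k=1..n. (w * (real n + 1) / (real k * (real k + 1))) powr p)"
    using greedy_run_cost_le[OF \<open>0 < p\<close> greedy[unfolded greedy_matching_def] _ _
        permutes_imp_bij[OF \<sigma>], of n] M
    by (auto simp: w_eq matching_cost_def)
  also have "\<dots> \<le> (\<Sum>k=1..n. 2 powr p * w powr p * (real n powr p * real k powr (- 2 * p)))"
  proof (rule sum_mono)
    fix k assume k: "k \<in> {1..n}"
    \<comment> \<open>\<open>n + 1 \<le> 2 n\<close> holds because \<open>1 \<le> k \<le> n\<close>\<close>
    have "w * (real n + 1) / (real k * (real k + 1)) \<le> w * (2 * real n) / (real k * real k)"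
      using k \<open>0 \<le> w\<close> by (intro frac_le mult_left_mono mult_nonneg_nonneg) auto
    then have "(w * (real n + 1) / (real k * (real k + 1))) powr p
        \<le> (w * (2 * real n) / (real k * real k)) powr p"
      using \<open>0 < p\<close> \<open>0 \<le> w\<close> by (intro powr_mono2) auto
    also have "\<dots> = 2 powr p * w powr p * (real n powr p * (1 / (real k * real k) powr p))"
      using \<open>0 \<le> w\<close> by (simp add: powr_mult powr_divide)
    also have "1 / (real k * real k) powr p = real k powr (- 2 * p)"
      by (simp add: powr_mult powr_minus_divide flip: powr_add)
    finally show "(w * (real n + 1) / (real k * (real k + 1))) powr p
        \<le> 2 powr p * w powr p * (real n powr p * real k powr (- 2 * p))" .
  qed
  also have "\<dots> = 2 powr p * w powr p * (real n powr p * (\<Sum>k=1..n. real k powr (- 2 * p)))"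
    by (simp add: sum_distrib_left)
  finally show ?thesis
    by (simp add: w_def)
qed

section \<open>Growth of partial sums of powers\<close>

text \<open>
  The induction step compares one summand with an increment of \<open>t \<mapsto> t\<^sup>1\<^sup>-\<^sup>s / (1 - s)\<close>. It is the
  weighted inequality of arithmetic and geometric means for \<open>n / (n + 1)\<close> and \<open>1\<close>.
\<close>

lemma sum_powr_neg_le:
  fixes s :: real
  assumes "0 < s" "s < 1"
  shows "(\<Sum>k=1..n. real k powr (- s)) \<le> real n powr (1 - s) / (1 - s)"
proof (induction n)
  case 0
  then show ?case by simp
next
  case (Suc n)
  have "(1 - s) * real (Suc n) powr (- s) \<le> real (Suc n) powr (1 - s) - real n powr (1 - s)"
  proof (cases "n = 0")
    case True
    then show ?thesis using assms by simp
  next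
    case False
    let ?t = "real n / real (Suc n)"
    have "?t powr (1 - s) * 1 powr s \<le> (1 - s) * ?t + s * 1"
      using assms False by (intro Youngs_inequality_0) auto
    also have "\<dots> = 1 - (1 - s) / real (Suc n)"
      by (simp add: divide_simps algebra_simps)
    finally have "?t powr (1 - s) \<le> 1 - (1 - s) / real (Suc n)"
      by simp
    then have "real (Suc n) powr (1 - s) * ?t powr (1 - s)
        \<le> real (Suc n) powr (1 - s) * (1 - (1 - s) / real (Suc n))"
      by (intro mult_left_mono) auto
    also have "\<dots> = real (Suc n) powr (1 - s) - (1 - s) * (real (Suc n) powr (1 - s) / real (Suc n))"
      by (simp add: right_diff_distrib mult.commute)
    also have "real (Suc n) powr (1 - s) / real (Suc n) = real (Suc n) powr (- s)"
      by (simp add: powr_diff powr_minus_divide)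
    also have "real (Suc n) powr (1 - s) * ?t powr (1 - s) = real n powr (1 - s)"
      by (simp add: powr_divide del: of_nat_Suc)
    finally show ?thesis
      by linarith
  qed
  then have "real (Suc n) powr (- s)
      \<le> real (Suc n) powr (1 - s) / (1 - s) - real n powr (1 - s) / (1 - s)"
    using assms by (simp add: pos_le_divide_eq mult.commute flip: diff_divide_distrib)
  with Suc show ?case by simp
qed

lemma harm_le_ln_plus_1:
  assumes "0 < n"
  shows "harm n \<le> ln (real n) + 1"
proof -
  obtain m where n: "n = Suc m"
    using assms gr0_implies_Suc by blast
  have "harm (Suc m) - ln (real (Suc m)) \<le> harm (Suc 0) - ln (real (Suc 0))"
    using decseqD[OF decseq_harm_diff_ln, of 0 m] by simp
  then show ?thesis
    by (simp add: n harm_def)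
qed

definition greedy_rate :: "real \<Rightarrow> nat \<Rightarrow> real" where
  "greedy_rate p n =
     (if p < 1 / 2 then real n powr (1 - p)
      else if p = 1 / 2 then sqrt (real n) * ln (real n)
      else real n powr p)"

lemma powr_times_sum_powr_le_greedy_rate:
  assumes "0 < p"
  obtains C where "0 < C"
    "\<And>n. (p = 1 / 2 \<longrightarrow> 2 \<le> n) \<Longrightarrow>
      real n powr p * (\<Sum>k=1..n. real k powr (- 2 * p)) \<le> C * greedy_rate p n"
proof -
  consider "p < 1 / 2" | "p = 1 / 2" | "1 / 2 < p"
    by linarith
  then show thesis
  proof cases
    case 1
    have "real n powr p * (\<Sum>k=1..n. real k powr (- 2 * p)) \<le> 1 / (1 - 2 * p) * greedy_rate p n" for n
    proof -
      have "real n powr p * (\<Sum>k=1..n. real k powr (- 2 * p))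
          \<le> real n powr p * (real n powr (1 - 2 * p) / (1 - 2 * p))"
        using sum_powr_neg_le[of "2 * p" n] 1 assms by (intro mult_left_mono) auto
      also have "\<dots> = 1 / (1 - 2 * p) * real n powr (1 - p)"
        by (simp add: powr_add[symmetric])
      finally show ?thesis
        using 1 by (simp add: greedy_rate_def)
    qed
    then show thesis
      using 1 that[of "1 / (1 - 2 * p)"] by simp
  next
    case 2
    have bound: "real n powr p * (\<Sum>k=1..n. real k powr (- 2 * p)) \<le> (1 + 1 / ln 2) * greedy_rate p n"
      if "2 \<le> n" for n
    proof -
      have "(\<Sum>k=1..n. real k powr (- 2 * p)) = harm n"
        unfolding harm_def 2 by (intro sum.cong) (auto simp: powr_minus)
      also have "\<dots> \<le> ln (real n) + 1"
        using that by (intro harm_le_ln_plus_1) simp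
      \<comment> \<open>the additive constant is absorbed because \<open>ln n \<ge> ln 2\<close>\<close>
      also have "\<dots> \<le> (1 + 1 / ln 2) * ln (real n)"
        using that by (simp add: field_simps)
      finally have "sqrt (real n) * (\<Sum>k=1..n. real k powr (- 2 * p))
          \<le> sqrt (real n) * ((1 + 1 / ln 2) * ln (real n))"
        by (intro mult_left_mono) auto
      then show ?thesis
        unfolding greedy_rate_def 2 by (simp add: powr_half_sqrt mult_ac)
    qed
    show thesis
    proof (rule that)
      show "0 < 1 + 1 / ln (2 :: real)"
        by (simp add: add_pos_pos)
    qed (use bound 2 in blast)
  next
    case 3
    have summable: "summable (\<lambda>k. real k powr (- 2 * p))"
      using 3 by (subst summable_real_powr_iff) simp
    let ?S = "\<Sum>k. real k powr (- 2 * p)"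
    have "?S > 0"
      using summable by (rule suminf_pos2[where i = 1]) auto
    moreover have "real n powr p * (\<Sum>k=1..n. real k powr (- 2 * p)) \<le> ?S * greedy_rate p n" for n
    proof -
      have "(\<Sum>k=1..n. real k powr (- 2 * p)) \<le> ?S"
        using summable by (intro sum_le_suminf) auto
      then have "real n powr p * (\<Sum>k=1..n. real k powr (- 2 * p)) \<le> real n powr p * ?S"
        by (intro mult_left_mono) auto
      then show ?thesis
        using 3 by (simp add: greedy_rate_def mult.commute)
    qed
    ultimately show thesis
      using that by blast
  qed
qed

section \<open>The greedy matching bound\<close>

theorem theorem1:
  fixes p :: real
  assumes "0 < p" and "p < 1"
  shows "\<exists>c > 0. \<forall>(M :: 'a set) (d :: 'a \<Rightarrow> 'a \<Rightarrow> real) (n :: nat) (x :: nat \<Rightarrow> 'a) (y :: nat \<Rightarrow> 'a)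
           (\<pi> :: nat \<Rightarrow> nat).
           Metric_space M d \<longrightarrow>
           (\<forall>i \<in> {1..n}. x i \<in> M \<and> y i \<in> M) \<longrightarrow>
           (p = 1 / 2 \<longrightarrow> 2 \<le> n) \<longrightarrow>
           greedy_matching (\<lambda>u v. d u v powr p) n x y \<pi> \<longrightarrow>
           matching_cost (\<lambda>u v. d u v powr p) n x y \<pi>
             \<le> c * wasserstein1 d n x y powr p *
               (if p < 1 / 2 then real n powr (1 - p)
                else if p = 1 / 2 then sqrt (real n) * ln (real n)
                else real n powr p)"
proof -
  obtain C where "0 < C" and C: "\<And>n. (p = 1 / 2 \<longrightarrow> 2 \<le> n) \<Longrightarrow>
      real n powr p * (\<Sum>k=1..n. real k powr (- 2 * p)) \<le> C * greedy_rate p n"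
    using powr_times_sum_powr_le_greedy_rate[OF \<open>0 < p\<close>] by blast
  have "matching_cost (\<lambda>u v. d u v powr p) n x y \<pi>
      \<le> 2 powr p * C * wasserstein1 d n x y powr p * greedy_rate p n"
    if "Metric_space M d" "\<forall>i \<in> {1..n}. x i \<in> M \<and> y i \<in> M" "p = 1 / 2 \<longrightarrow> 2 \<le> n"
      "greedy_matching (\<lambda>u v. d u v powr p) n x y \<pi>"
    for M :: "'a set" and d n x y \<pi>
  proof -
    have "matching_cost (\<lambda>u v. d u v powr p) n x y \<pi>
        \<le> 2 powr p * wasserstein1 d n x y powr p * (real n powr p * (\<Sum>k=1..n. real k powr (- 2 * p)))"
      by (rule Metric_space.greedy_cost_le_wasserstein1[OF that(1) \<open>0 < p\<close> that(4,2)])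
    also have "\<dots> \<le> 2 powr p * wasserstein1 d n x y powr p * (C * greedy_rate p n)"
      by (intro mult_left_mono C that(3)) auto
    finally show ?thesis
      by (simp add: mult_ac)
  qed
  then show ?thesis
    unfolding greedy_rate_def[symmetric] using \<open>0 < C\<close>
    by (intro exI[of _ "2 powr p * C"] conjI allI impI) simp_all
qed

end
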